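(* Let $h:\Sigma^c\to\Sigma^d$ be a simple tabulation hash function, let $\varepsilon>0$ be a constant, and let $X$ be a set of keys with $|X|\le|\Sigma|/(1+\varepsilon)$. Then $h$ is fully peelable on $X$ with probability $1-O(|\Sigma|^{1-\lfloor d/2\rfloor})$.
   Context: Simple tabulation: fix an integer $c\ge1$ and an alphabet $\Sigma$ whose size is a power of two; keys are vectors $(x_0,\dots,x_{c-1})\in\Sigma^c$. A simple tabulation function $h:\Sigma^c\to\Sigma^d$ is given by $c$ independent fully random tables $T_i:\Sigma\to\Sigma^d$ with $h(x)=T_0[x_0]\oplus\cdots\oplus T_{c-1}[x_{c-1}]$ (bitwise XOR). $h$ is fully peelable on $X$ if for every non-empty subset $Y\subseteq X$ there exists $y\in Y$ such that $h(y)$ has a unique output character, i.e. there is a position $j\in[d]$ with $h(y)_j\ne h(y')_j$ for all $y'\in Y\setminus\{y\}$. Standing assumptions: $c,d=O(1)$; constants in $O(\cdot)$ may depend on $c,d,\varepsilon$. *)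

theory Defs
  imports "HOL-Probability.Probability"
begin

unbundle bit_operations_syntax

text \<open>
  An alphabet whose size is a power of two is represented by the \<open>b\<close>-bit numbers, so that
  bitwise exclusive or of characters is the library operation on natural numbers.
\<close>

definition alphabet :: "nat \<Rightarrow> nat set" where
  "alphabet b = {..<2 ^ b}"

definition vectors :: "nat \<Rightarrow> nat \<Rightarrow> (nat \<Rightarrow> nat) set" where
  "vectors b n = ({..<n} \<rightarrow>\<^sub>E alphabet b)"

text \<open>
  \<open>T i a j\<close> is the character at position \<open>j\<close> of the entry for the input character \<open>a\<close> in the
  \<open>i\<close>-th table.  \<open>Pi_pmf\<close> makes the \<open>c\<close> tables independent; each of them is a uniformly random
  function from characters to vectors of \<open>d\<close> characters.
\<close>

definition random_tables :: "nat \<Rightarrow> nat \<Rightarrow> nat \<Rightarrow> (nat \<Rightarrow> nat \<Rightarrow> nat \<Rightarrow> nat) pmf" where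
  "random_tables b c d =
     Pi_pmf {..<c} undefined (\<lambda>_. pmf_of_set (alphabet b \<rightarrow>\<^sub>E vectors b d))"

definition simple_tabulation ::
    "nat \<Rightarrow> nat \<Rightarrow> (nat \<Rightarrow> nat \<Rightarrow> nat \<Rightarrow> nat) \<Rightarrow> (nat \<Rightarrow> nat) \<Rightarrow> (nat \<Rightarrow> nat)" where
  "simple_tabulation c d T x =
     (\<lambda>j\<in>{..<d}. foldr (\<lambda>i r. T i (x i) j XOR r) [0..<c] 0)"

definition has_unique_output_char ::
    "nat \<Rightarrow> ('k \<Rightarrow> nat \<Rightarrow> nat) \<Rightarrow> 'k set \<Rightarrow> 'k \<Rightarrow> bool" where
  "has_unique_output_char d h Y y \<longleftrightarrow> (\<exists>j<d. \<forall>y'\<in>Y - {y}. h y j \<noteq> h y' j)"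

definition fully_peelable :: "nat \<Rightarrow> ('k \<Rightarrow> nat \<Rightarrow> nat) \<Rightarrow> 'k set \<Rightarrow> bool" where
  "fully_peelable d h X \<longleftrightarrow>
     (\<forall>Y. Y \<subseteq> X \<and> Y \<noteq> {} \<longrightarrow> (\<exists>y\<in>Y. has_unique_output_char d h Y y))"

end

theory Submission
  imports Defs
begin

text \<open>
  Group the output positions into \<open>d div 2\<close> disjoint pairs.  For one pair the keys are the edges of
  a random bipartite graph with \<open>2 ^ b\<close> vertices on each side.  In a set of keys without a unique
  output character every edge meets another edge of the set at both ends, so each such key lies in
  the 2-core of every pair graph, and the pairs are independent.

  The expected number of edges in the 2-core is \<open>O(card S / 2 ^ b)\<close> for every set \<open>S\<close> with
  \<open>card S \<le> 2 ^ b / (1 + \<epsilon>)\<close>.  Indeed, from an edge of the core starts an infinite walk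
  \<open>x 0, x 1, \<dots>\<close> in which consecutive edges are distinct and meet alternately on the two sides.
  Each meeting is a linear equation over the field with two elements for the table entries, and
  \<open>n\<close> independent equations hold with probability \<open>(2 ^ b) powi (- n)\<close>.  When equation \<open>n\<close> is the
  first one in the span of its predecessors, the sum of some four keys
  \<open>x i, x (i + 1), x n, x (n + 1)\<close> consists of few entries of the other keys; four keys with a
  prescribed sum can be chosen in \<open>O(card S ^ 2)\<close> ways only, so there are at most
  \<open>poly(n) * card S ^ n\<close> such walks.  Summation over \<open>n\<close> converges because
  \<open>card S / 2 ^ b < 1\<close>, and long walks without dependency are negligible.

  A fixed key may lie in the core with a much larger probability than \<open>O(1 / 2 ^ b)\<close>, but some key
  of \<open>S\<close> does not.  Removing such light keys from \<open>X\<close> one at a time, each step costs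
  \<open>O((2 ^ b) powi (- (d div 2)))\<close>.
\<close>

section \<open>Random solutions of linear equations over the field with two elements\<close>

lemma odd_card_sym_diff:
  assumes "finite A" "finite B"
  shows "odd (card (sym_diff A B)) \<longleftrightarrow> odd (card A) \<noteq> odd (card B)"
proof -
  have "card (sym_diff A B) = card (A - B) + card (B - A)"
    using assms by (intro card_Un_disjoint) auto
  moreover have "card A = card (A - B) + card (A \<inter> B)"
    using assms(1) by (subst card_Un_disjoint[symmetric]) (auto intro: arg_cong[of _ _ card])
  moreover have "card B = card (B - A) + card (A \<inter> B)"
    using assms(2) by (subst card_Un_disjoint[symmetric]) (auto intro: arg_cong[of _ _ card])
  ultimately show ?thesis by auto
qed

text \<open>A set stands for its indicator vector over the field with two elements; the set built
  from \<open>U\<close> is the sum of the vectors \<open>E i\<close> with \<open>i\<close> in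
  \<open>U\<close>.\<close>

definition in_span :: "(nat \<Rightarrow> 'a set) \<Rightarrow> nat \<Rightarrow> 'a set \<Rightarrow> bool" where
  "in_span E n v \<longleftrightarrow> (\<exists>U\<subseteq>{..<n}. v = {p. odd (card {i\<in>U. p \<in> E i})})"

lemma in_span_Suc:
  assumes "in_span E n v \<or> in_span E n (sym_diff v (E n))"
  shows "in_span E (Suc n) v"
  using assms
proof
  assume "in_span E n v"
  then obtain U where "U \<subseteq> {..<n}" "v = {p. odd (card {i\<in>U. p \<in> E i})}"
    unfolding in_span_def by blast
  moreover from this have "U \<subseteq> {..<Suc n}" by auto
  ultimately show ?thesis unfolding in_span_def by blast
next
  assume "in_span E n (sym_diff v (E n))"
  then obtain U where U: "U \<subseteq> {..<n}" "sym_diff v (E n) = {p. odd (card {i\<in>U. p \<in> E i})}"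
    unfolding in_span_def by blast
  have "p \<in> v \<longleftrightarrow> odd (card {i \<in> insert n U. p \<in> E i})" for p
  proof -
    have fin: "finite {i\<in>U. p \<in> E i}" and notin: "n \<notin> {i\<in>U. p \<in> E i}"
      using U(1) finite_subset[OF U(1)] by auto
    have v: "p \<in> v \<longleftrightarrow> ((p \<in> E n) \<noteq> odd (card {i\<in>U. p \<in> E i}))"
      using U(2) by blast
    show ?thesis
    proof (cases "p \<in> E n")
      case True
      then have "{i \<in> insert n U. p \<in> E i} = insert n {i\<in>U. p \<in> E i}" by auto
      then show ?thesis using v True card_insert_disjoint[OF fin notin] by simp
    next
      case False
      then have "{i \<in> insert n U. p \<in> E i} = {i\<in>U. p \<in> E i}" by auto
      then show ?thesis using v False by simp
    qed
  qed
  then have "v = {p. odd (card {i \<in> insert n U. p \<in> E i})}" by blast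
  moreover have "insert n U \<subseteq> {..<Suc n}" using U(1) by auto
  ultimately show ?thesis unfolding in_span_def by blast
qed

text \<open>The set \<phi> acts as the linear functional that sends \<open>w\<close> to the parity
  of its intersection with \<phi>. Neither \<open>v\<close> nor \<open>v + E n\<close> lies in the
  span of the first \<open>n\<close> vectors, so induction yields a functional for each; one of the
  two or their sum also vanishes on \<open>E n\<close>.\<close>

lemma separating_functional:
  assumes "\<And>i. i < n \<Longrightarrow> finite (E i)" "finite v" "\<not> in_span E n v"
  shows "\<exists>\<phi>. (\<forall>i<n. even (card (\<phi> \<inter> E i))) \<and> odd (card (\<phi> \<inter> v))"
  using assms
proof (induction n arbitrary: v)
  case 0
  then have "v \<noteq> {}" by (auto simp: in_span_def)
  then obtain p where "p \<in> v" by blast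
  then show ?case by (intro exI[of _ "{p}"]) auto
next
  case (Suc n)
  have fin: "finite (\<phi> \<inter> E i)" "finite (\<phi> \<inter> v)" if "i \<le> n" for \<phi> i
    using Suc.prems that by auto
  have symL: "sym_diff \<phi> \<psi> \<inter> w = sym_diff (\<phi> \<inter> w) (\<psi> \<inter> w)" for \<phi> \<psi> w :: "'a set" by auto
  have symR: "\<phi> \<inter> sym_diff w w' = sym_diff (\<phi> \<inter> w) (\<phi> \<inter> w')" for \<phi> w w' :: "'a set" by auto
  obtain \<phi> where \<phi>: "\<And>i. i < n \<Longrightarrow> even (card (\<phi> \<inter> E i))" "odd (card (\<phi> \<inter> v))"
    using Suc.IH[of v] Suc.prems in_span_Suc[of E n v] by auto
  have "\<not> in_span E n (sym_diff v (E n))" "finite (sym_diff v (E n))"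
    using Suc.prems in_span_Suc[of E n v] by auto
  then obtain \<psi> where \<psi>: "\<And>i. i < n \<Longrightarrow> even (card (\<psi> \<inter> E i))"
      "odd (card (\<psi> \<inter> sym_diff v (E n)))"
    using Suc.IH[of "sym_diff v (E n)"] Suc.prems(1) by auto
  have \<psi>': "odd (card (\<psi> \<inter> v)) \<noteq> odd (card (\<psi> \<inter> E n))"
    using \<psi>(2) unfolding symR using odd_card_sym_diff[OF fin(2) fin(1)] by blast
  have sum: "odd (card (sym_diff \<phi> \<psi> \<inter> w)) \<longleftrightarrow> odd (card (\<phi> \<inter> w)) \<noteq> odd (card (\<psi> \<inter> w))"
    if "finite w" for w
    unfolding symL using that by (intro odd_card_sym_diff) auto
  \<comment> \<open>If both functionals are 1 on \<open>E n\<close>, then \<psi> is 0 on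
    \<open>v\<close>, because its values on \<open>v\<close> and \<open>E n\<close> differ. Their
    sum is then 0 on \<open>E n\<close> and 1 on \<open>v\<close>.\<close>
  consider "even (card (\<phi> \<inter> E n))" | "even (card (\<psi> \<inter> E n))"
    | "odd (card (\<phi> \<inter> E n))" "odd (card (\<psi> \<inter> E n))" by blast
  then show ?case
  proof cases
    case 1 then show ?thesis using \<phi> by (intro exI[of _ \<phi>]) (auto simp: less_Suc_eq)
  next
    case 2 then show ?thesis using \<psi>(1) \<psi>' by (intro exI[of _ \<psi>]) (auto simp: less_Suc_eq)
  next
    case 3
    have "even (card (sym_diff \<phi> \<psi> \<inter> E i))" if "i < Suc n" for i
      using that 3 \<phi>(1)[of i] \<psi>(1)[of i] sum[of "E i"] Suc.prems(1)[of i]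
      by (cases "i = n") (blast, simp)
    moreover have "odd (card (sym_diff \<phi> \<psi> \<inter> v))"
      using 3 \<phi>(2) \<psi>' sum[OF Suc.prems(2)] by blast
    ultimately show ?thesis by blast
  qed
qed

text \<open>
  Bit by bit, this says that the exclusive or of \<open>T p\<close> over \<open>p \<in> v\<close> is \<open>0\<close>.
\<close>

definition annihilates :: "('a \<Rightarrow> nat) \<Rightarrow> 'a set \<Rightarrow> bool" where
  "annihilates T v \<longleftrightarrow> (\<forall>n. even (card {p\<in>v. bit (T p) n}))"

lemma xor_in_alphabet: "x \<in> alphabet b \<Longrightarrow> y \<in> alphabet b \<Longrightarrow> x XOR y \<in> alphabet b"
  by (simp add: alphabet_def flip: take_bit_nat_eq_self_iff)

text \<open>A functional that is 0 on the earlier equations and 1 on \<open>E n\<close> yields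
  \<open>2 ^ b\<close> disjoint translates of the smaller solution set inside the larger
  one.\<close>

lemma card_annihilators_Suc:
  fixes E :: "nat \<Rightarrow> 'a set"
  assumes "finite I" "\<And>i. i \<le> n \<Longrightarrow> E i \<subseteq> I" "\<not> in_span E n (E n)"
  shows "card {T \<in> I \<rightarrow>\<^sub>E alphabet b. \<forall>i<Suc n. annihilates T (E i)} * 2 ^ b
    \<le> card {T \<in> I \<rightarrow>\<^sub>E alphabet b. \<forall>i<n. annihilates T (E i)}" (is "card ?G' * _ \<le> card ?G")
proof -
  have finE: "finite (E i)" if "i \<le> n" for i using assms(1,2) that finite_subset by blast
  obtain \<phi> where \<phi>: "\<And>i. i < n \<Longrightarrow> even (card (\<phi> \<inter> E i))" "odd (card (\<phi> \<inter> E n))"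
    using separating_functional[of n E "E n"] finE assms(3) by auto
  \<comment> \<open>Adding \<open>z\<close> on \<open>\<phi>\<close> preserves the first \<open>n\<close> equations and changes the value of the last one by \<open>z\<close>.\<close>
  define \<tau> where "\<tau> T z = (\<lambda>p\<in>I. if p \<in> \<phi> then T p XOR z else T p)" for T :: "'a \<Rightarrow> nat" and z :: nat
  have parity: "odd (card {p \<in> E i. bit (\<tau> T z p) k}) \<longleftrightarrow>
      odd (card {p \<in> E i. bit (T p) k}) \<noteq> (bit z k \<and> odd (card (\<phi> \<inter> E i)))" if "i \<le> n" for i T z k
  proof -
    have "{p \<in> E i. bit (\<tau> T z p) k} =
        sym_diff {p \<in> E i. bit (T p) k} (if bit z k then \<phi> \<inter> E i else {})"
      using assms(2)[OF that] by (auto simp: \<tau>_def bit_xor_iff)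
    then show ?thesis using finE[OF that] by (auto simp: odd_card_sym_diff)
  qed
  have "inj_on (\<lambda>(T, z). \<tau> T z) (?G' \<times> alphabet b)"
  proof (rule inj_onI, clarify)
    fix T z T' z'
    assume *: "T \<in> I \<rightarrow>\<^sub>E alphabet b" "T' \<in> I \<rightarrow>\<^sub>E alphabet b" "\<tau> T z = \<tau> T' z'"
      "\<forall>i<Suc n. annihilates T (E i)" "\<forall>i<Suc n. annihilates T' (E i)"
    \<comment> \<open>Both \<open>T\<close> and \<open>T'\<close> satisfy the last equation, so its
      value at the common translate reveals \<open>z\<close>.\<close>
    have "bit z k \<longleftrightarrow> bit z' k" for k
      using parity[of n T z k] parity[of n T' z' k] * \<phi>(2) by (auto simp: annihilates_def)
    then have z: "z = z'" by (rule bit_eqI)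
    have cancel: "x = y" if "x XOR z = y XOR z" for x y :: nat
    proof -
      have "x = (x XOR z) XOR z" "y = (y XOR z) XOR z" by (simp_all add: xor.assoc)
      then show ?thesis using that by simp
    qed
    have "T p = T' p" for p
    proof (cases "p \<in> I")
      case True
      then have "(if p \<in> \<phi> then T p XOR z else T p) = (if p \<in> \<phi> then T' p XOR z else T' p)"
        using fun_cong[OF *(3), of p] z by (auto simp: \<tau>_def split: if_splits)
      then show ?thesis using cancel by (simp split: if_splits)
    qed (use * in \<open>auto simp: PiE_def extensional_def\<close>)
    then show "T = T' \<and> z = z'" using z by auto
  qed
  moreover have "(\<lambda>(T, z). \<tau> T z) ` (?G' \<times> alphabet b) \<subseteq> ?G"
  proof (clarify, intro conjI)
    fix T z
    assume *: "T \<in> I \<rightarrow>\<^sub>E alphabet b" "z \<in> alphabet b" "\<forall>i<Suc n. annihilates T (E i)"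
    show "\<tau> T z \<in> I \<rightarrow>\<^sub>E alphabet b"
      using * by (auto simp: \<tau>_def intro!: xor_in_alphabet)
    show "\<forall>i<n. annihilates (\<tau> T z) (E i)"
      using * \<phi>(1) parity[OF less_imp_le, of _ T z] by (auto simp: annihilates_def)
  qed
  moreover have "finite (I \<rightarrow>\<^sub>E alphabet b)" using assms(1) by (auto simp: alphabet_def intro: finite_PiE)
  ultimately have "card (?G' \<times> alphabet b) \<le> card ?G"
    by (intro card_inj_on_le) auto
  then show ?thesis by (simp add: card_cartesian_product alphabet_def)
qed

lemma card_annihilators_le:
  assumes "finite I" "\<And>i. i < n \<Longrightarrow> E i \<subseteq> I" "\<And>i. i < n \<Longrightarrow> \<not> in_span E i (E i)"
  shows "card {T \<in> I \<rightarrow>\<^sub>E alphabet b. \<forall>i<n. annihilates T (E i)} * (2 ^ b) ^ n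
    \<le> card (I \<rightarrow>\<^sub>E alphabet b)"
  using assms
proof (induction n)
  case (Suc n)
  have "card {T \<in> I \<rightarrow>\<^sub>E alphabet b. \<forall>i<Suc n. annihilates T (E i)} * (2 ^ b) ^ Suc n
    \<le> card {T \<in> I \<rightarrow>\<^sub>E alphabet b. \<forall>i<n. annihilates T (E i)} * (2 ^ b) ^ n"
    using card_annihilators_Suc[of I n E b] Suc.prems by (simp add: mult.assoc[symmetric])
  also have "\<dots> \<le> card (I \<rightarrow>\<^sub>E alphabet b)" using Suc by simp
  finally show ?case .
qed simp

section \<open>Quadruples of keys with a prescribed sum\<close>

text \<open>All three counts are sums over values of products of fibre sizes, and
  \<open>2 * (x * y) \<le> x * x + y * y\<close> holds termwise. When \<open>g\<close> is
  \<open>f\<close> followed by an injection, both counts on the right agree, so \<open>f\<close>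
  meets \<open>g\<close> at most as often as itself.\<close>

lemma card_collisions_le:
  fixes f g :: "'a \<Rightarrow> 'b"
  assumes "finite A"
  shows "2 * card {(a, a') \<in> A \<times> A. f a = g a'}
    \<le> card {(a, a') \<in> A \<times> A. f a = f a'} + card {(a, a') \<in> A \<times> A. g a = g a'}"
proof -
  define B where "B = f ` A \<union> g ` A"
  define N where "N f y = card {a \<in> A. f a = y}" for f :: "'a \<Rightarrow> 'b" and y
  have finB: "finite B" using assms by (simp add: B_def)
  have eq: "card {(a, a') \<in> A \<times> A. p a = q a'} = (\<Sum>y\<in>B. N p y * N q y)" if "p ` A \<subseteq> B" for p q
  proof -
    have "{(a, a') \<in> A \<times> A. p a = q a'} = (\<Union>y\<in>B. {a \<in> A. p a = y} \<times> {a \<in> A. q a = y})"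
      using that by auto
    also have "card \<dots> = (\<Sum>y\<in>B. card ({a \<in> A. p a = y} \<times> {a \<in> A. q a = y}))"
      using finB assms by (intro card_UN_disjoint) auto
    finally show ?thesis by (simp add: card_cartesian_product N_def)
  qed
  have amgm: "2 * (x * y) \<le> x * x + y * y" for x y :: nat
  proof -
    have "0 \<le> (int x - int y)\<^sup>2" by simp
    then have "int (2 * (x * y)) \<le> int (x * x + y * y)"
      by (simp add: power2_eq_square algebra_simps)
    then show ?thesis by linarith
  qed
  have "2 * (\<Sum>y\<in>B. N f y * N g y) \<le> (\<Sum>y\<in>B. N f y * N f y) + (\<Sum>y\<in>B. N g y * N g y)"
    unfolding sum_distrib_left sum.distrib[symmetric] by (intro sum_mono amgm)
  moreover have "f ` A \<subseteq> B" "g ` A \<subseteq> B" by (auto simp: B_def)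
  ultimately show ?thesis using eq[of f g] eq[of f f] eq[of g g] by linarith
qed

text \<open>Symmetric difference of the sets of entries read by the two keys: the coefficient vector
  of the equation that both have the same output character.\<close>

definition key_diff :: "nat \<Rightarrow> (nat \<Rightarrow> nat) \<Rightarrow> (nat \<Rightarrow> nat) \<Rightarrow> (nat \<times> nat) set" where
  "key_diff c x y = {(k, a). k < c \<and> (x k = a) \<noteq> (y k = a)}"

lemma key_diff_nonempty:
  assumes "x \<in> vectors b c" "y \<in> vectors b c" "x \<noteq> y"
  shows "key_diff c x y \<noteq> {}"
proof -
  obtain k where "k < c" "x k \<noteq> y k"
    using assms PiE_ext[of x "{..<c}" "\<lambda>_. alphabet b" y] unfolding vectors_def by auto
  then have "(k, x k) \<in> key_diff c x y" by (auto simp: key_diff_def)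
  then show ?thesis by blast
qed

lemma key_diff_entries: "key_diff c x y \<subseteq> (\<lambda>k. (k, x k)) ` {..<c} \<union> (\<lambda>k. (k, y k)) ` {..<c}"
  by (auto simp: key_diff_def)

text \<open>An ordered refinement of \<open>key_diff\<close>: it also remembers which of two
  different characters belongs to which key, which makes collisions easy to count.\<close>

definition diff_pattern :: "(nat \<Rightarrow> nat) \<times> (nat \<Rightarrow> nat) \<Rightarrow> nat \<Rightarrow> (nat \<times> nat) option" where
  "diff_pattern = (\<lambda>(x, y) k. if x k = y k then None else Some (x k, y k))"

definition swap_pattern :: "nat set \<Rightarrow> (nat \<Rightarrow> (nat \<times> nat) option) \<Rightarrow> nat \<Rightarrow> (nat \<times> nat) option" where
  "swap_pattern P f = (\<lambda>k. if k \<in> P then map_option (\<lambda>(x, y). (y, x)) (f k) else f k)"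

lemma inj_swap_pattern: "inj (swap_pattern P)"
proof (rule inj_on_inverseI)
  show "swap_pattern P (swap_pattern P f) = f" for f
  proof
    show "swap_pattern P (swap_pattern P f) k = f k" for k
      by (cases "f k") (auto simp: swap_pattern_def)
  qed
qed

text \<open>Equal differences fix the unordered pair of characters wherever the keys differ, so the
  ordered pairs agree or are reversed. Positions with \<open>z k = w k\<close> may enter the swap
  set harmlessly, since the pattern is \<open>None\<close> there.\<close>

lemma key_diff_eq_imp_diff_pattern:
  assumes "x \<in> vectors b c" "y \<in> vectors b c" "z \<in> vectors b c" "w \<in> vectors b c"
    and eq: "key_diff c x y = key_diff c z w"
  shows "diff_pattern (x, y) = swap_pattern {k. k < c \<and> z k \<noteq> x k} (diff_pattern (z, w))"
proof
  fix k
  have iff: "(x k = a) \<noteq> (y k = a) \<longleftrightarrow> (z k = a) \<noteq> (w k = a)" if "k < c" for a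
    using eq that by (auto simp: key_diff_def set_eq_iff)
  show "diff_pattern (x, y) k = swap_pattern {k. k < c \<and> z k \<noteq> x k} (diff_pattern (z, w)) k"
  proof (cases "k < c")
    case True
    show ?thesis
    proof (cases "x k = y k")
      case eq: True
      then have "z k = w k" using iff[OF True, of "z k"] by simp
      then show ?thesis using eq by (simp add: diff_pattern_def swap_pattern_def)
    next
      case neq: False
      show ?thesis
      proof (cases "z k = x k")
        case zx: True
        then have "w k = y k" using iff[OF True, of "y k"] neq by simp
        then show ?thesis using neq zx by (simp add: diff_pattern_def swap_pattern_def)
      next
        case zx: False
        then have "w k = x k" using iff[OF True, of "x k"] neq by simp
        moreover from this have "z k = y k" using iff[OF True, of "y k"] neq by simp
        ultimately show ?thesis using neq zx True by (simp add: diff_pattern_def swap_pattern_def)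
      qed
    qed
  next
    \<comment> \<open>Beyond position \<open>c\<close> all keys take the same default value, so both
      patterns are \<open>None\<close>.\<close>
    case False
    then show ?thesis using assms(1-4)
      by (simp add: diff_pattern_def swap_pattern_def vectors_def PiE_def extensional_def)
  qed
qed

text \<open>For pairs \<open>(x, y)\<close> and \<open>(x', y')\<close> with equal patterns,
  \<open>x' = x\<close> and \<open>y = y'\<close> hold where \<open>x\<close> and \<open>y\<close>
  differ, while \<open>y = x\<close> and \<open>x' = y'\<close> hold elsewhere. So the set of
  differing positions together with \<open>x\<close> and \<open>y'\<close> determines all four
  keys.\<close>

lemma card_diff_pattern_collisions_le:
  assumes "finite S" "S \<subseteq> vectors b c"
  shows "card {(p, q) \<in> (S \<times> S) \<times> (S \<times> S). diff_pattern p = diff_pattern q}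
    \<le> 2 ^ c * card S ^ 2" (is "card ?A \<le> _")
proof -
  define F :: "((nat \<Rightarrow> nat) \<times> (nat \<Rightarrow> nat)) \<times> (nat \<Rightarrow> nat) \<times> (nat \<Rightarrow> nat) \<Rightarrow> _"
    where "F = (\<lambda>((x, y), (x', y')). ({k. k < c \<and> x k \<noteq> y k}, x, y'))"
  have ext: "x k = y k" if "\<not> k < c" "x \<in> S" "y \<in> S" for x y k
  proof -
    have "x \<in> vectors b c" "y \<in> vectors b c" using that assms(2) by blast+
    then show ?thesis using that by (simp add: vectors_def PiE_def extensional_def)
  qed
  have "inj_on F ?A"
  proof (rule inj_onI)
    fix s t assume "s \<in> ?A" "t \<in> ?A" "F s = F t"
    moreover obtain x y x' y' u v u' v' where st: "s = ((x, y), (x', y'))" "t = ((u, v), (u', v'))"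
      by (metis surj_pair)
    ultimately have S: "x \<in> S" "y \<in> S" "x' \<in> S" "y' \<in> S" "u \<in> S" "v \<in> S" "u' \<in> S" "v' \<in> S"
      and d: "diff_pattern (x, y) = diff_pattern (x', y')" "diff_pattern (u, v) = diff_pattern (u', v')"
      and F: "F ((x, y), x', y') = F ((u, v), u', v')"
      by auto
    have xu: "x = u" "y' = v'" and Q: "{k. k < c \<and> x k \<noteq> y k} = {k. k < c \<and> u k \<noteq> v k}"
      using F by (auto simp: F_def)
    have "y k = v k \<and> x' k = u' k" for k
    proof (cases "k < c")
      case True
      then have "x k \<noteq> y k \<longleftrightarrow> u k \<noteq> v k" using Q by blast
      then show ?thesis using fun_cong[OF d(1), of k] fun_cong[OF d(2), of k] xu
        by (auto simp: diff_pattern_def split: if_splits)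
    qed (use S ext in blast)
    then have "y = v" "x' = u'" by auto
    then show "s = t" using xu st by simp
  qed
  moreover have "F ` ?A \<subseteq> Pow {..<c} \<times> S \<times> S" by (auto simp: F_def)
  ultimately have "card ?A \<le> card (Pow {..<c} \<times> S \<times> S)"
    using assms(1) by (intro card_inj_on_le[of F]) auto
  then show ?thesis by (simp add: card_cartesian_product card_Pow power2_eq_square)
qed

text \<open>There are \<open>2 ^ c\<close> swap sets. For each of them the swap is injective, so
  \<open>card_collisions_le\<close> reduces to equal patterns, at the cost of another
  \<open>2 ^ c\<close>.\<close>

lemma card_key_diff_collisions_le:
  assumes "finite S" "S \<subseteq> vectors b c"
  shows "card {((x, y), (z, w)) \<in> (S \<times> S) \<times> (S \<times> S). key_diff c x y = key_diff c z w}
    \<le> 4 ^ c * card S ^ 2" (is "card ?A \<le> _")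
proof -
  define B where "B P = {(p, q) \<in> (S \<times> S) \<times> (S \<times> S). diff_pattern p = swap_pattern P (diff_pattern q)}" for P
  have le: "card (B P) \<le> 2 ^ c * card S ^ 2" for P
  proof -
    define N where "N = card {(p, q) \<in> (S \<times> S) \<times> (S \<times> S). diff_pattern p = diff_pattern q}"
    have "2 * card (B P) \<le> N + N"
      using card_collisions_le[of "S \<times> S" diff_pattern "\<lambda>q. swap_pattern P (diff_pattern q)",
          OF finite_cartesian_product[OF assms(1) assms(1)]]
      unfolding inj_eq[OF inj_swap_pattern] N_def B_def .
    moreover have "N \<le> 2 ^ c * card S ^ 2"
      unfolding N_def by (fact card_diff_pattern_collisions_le[OF assms])
    ultimately show ?thesis by linarith
  qed
  have "?A \<subseteq> (\<Union>P\<in>Pow {..<c}. B P)"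
  proof (clarify)
    fix x y z w
    assume "x \<in> S" "y \<in> S" "z \<in> S" "w \<in> S" "key_diff c x y = key_diff c z w"
    then have "((x, y), (z, w)) \<in> B {k. k < c \<and> z k \<noteq> x k}"
      using key_diff_eq_imp_diff_pattern[of x b c y z w] assms(2) unfolding B_def by blast
    moreover have "{k. k < c \<and> z k \<noteq> x k} \<in> Pow {..<c}" by auto
    ultimately show "((x, y), (z, w)) \<in> (\<Union>P\<in>Pow {..<c}. B P)" by (rule UN_I[rotated])
  qed
  moreover have "finite (\<Union>P\<in>Pow {..<c}. B P)"
  proof (intro finite_UN_I)
    show "finite (B P)" for P
      by (rule finite_subset[of _ "(S \<times> S) \<times> (S \<times> S)"]) (simp add: B_def Collect_mono_iff subset_iff, simp add: assms(1))
  qed simp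
  ultimately have "card ?A \<le> card (\<Union>P\<in>Pow {..<c}. B P)" by (intro card_mono)
  also have "\<dots> \<le> (\<Sum>P\<in>Pow {..<c}. card (B P))" by (intro card_UN_le) simp
  also have "\<dots> \<le> (\<Sum>P\<in>Pow {..<c}. 2 ^ c * card S ^ 2)" by (intro sum_mono le)
  also have "\<dots> = 4 ^ c * card S ^ 2"
    using power_mult_distrib[of "2 :: nat" 2 c] by (simp add: card_Pow)
  finally show ?thesis .
qed

lemma card_four_sums_le:
  assumes "finite S" "S \<subseteq> vectors b c"
  shows "card {((x, y), (z, w)) \<in> (S \<times> S) \<times> (S \<times> S). sym_diff (key_diff c x y) (key_diff c z w) = v}
    \<le> 4 ^ c * card S ^ 2" (is "card ?A \<le> _")
proof -
  define f where "f = (\<lambda>(x, y). key_diff c x y)"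
  \<comment> \<open>Moving \<open>v\<close> to one side turns the claim into a collision of two shifts of one function, so
    by the Cauchy-Schwarz bound \<open>card_collisions_le\<close> the sum \<open>v = {}\<close> is the worst case.\<close>
  have sd: "sym_diff s t = v \<longleftrightarrow> s = sym_diff t v" for s t v :: "(nat \<times> nat) set"
    by blast
  have cancel: "sym_diff s v = sym_diff t v \<longleftrightarrow> s = t" for s t :: "(nat \<times> nat) set"
    by blast
  have A: "?A = {(p, q) \<in> (S \<times> S) \<times> (S \<times> S). f p = sym_diff (f q) v}"
    unfolding f_def sd by (simp add: split_def mem_Times_iff conj_assoc)
  have ff: "card {(p, q) \<in> (S \<times> S) \<times> (S \<times> S). f p = f q} \<le> 4 ^ c * card S ^ 2"
    using card_key_diff_collisions_le[OF assms] by (simp add: f_def split_def mem_Times_iff conj_assoc)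
  have "2 * card ?A \<le> card {(p, q) \<in> (S \<times> S) \<times> (S \<times> S). f p = f q} +
      card {(p, q) \<in> (S \<times> S) \<times> (S \<times> S). sym_diff (f p) v = sym_diff (f q) v}"
    unfolding A using card_collisions_le[of "S \<times> S" f "\<lambda>q. sym_diff (f q) v",
        OF finite_cartesian_product[OF assms(1) assms(1)]] .
  then show ?thesis using ff unfolding cancel by linarith
qed

section \<open>Walks with dependent equations\<close>

text \<open>The tag \<open>e\<close> makes the two sides use disjoint sets of entries, so equations
  at different sides cannot cancel.\<close>

definition link :: "nat \<Rightarrow> nat \<Rightarrow> (nat \<Rightarrow> nat) \<Rightarrow> (nat \<Rightarrow> nat) \<Rightarrow> (nat \<times> nat \<times> nat) set" where
  "link c e x y = {e} \<times> key_diff c x y"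

definition walk_eqn :: "nat \<Rightarrow> (nat \<Rightarrow> nat \<Rightarrow> nat) \<Rightarrow> nat \<Rightarrow> (nat \<times> nat \<times> nat) set" where
  "walk_eqn c x i = link c (i mod 2) (x i) (x (Suc i))"

text \<open>Candidates for the sum of four keys once the keys with index in \<open>I\<close> are
  fixed; \<open>4 * c\<close> allows \<open>c\<close> entries for each of the four.\<close>

definition small_combinations ::
    "nat \<Rightarrow> nat set \<Rightarrow> (nat \<Rightarrow> nat \<Rightarrow> nat) \<Rightarrow> (nat \<times> nat) set set" where
  "small_combinations c I x = {v. v \<subseteq> (\<Union>l\<in>I. (\<lambda>k. (k, x l k)) ` {..<c}) \<and> card v \<le> 4 * c}"

text \<open>Because of the side tags, \<open>D n\<close> is the sum of \<open>D j\<close> over the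
  indices \<open>j\<close> in \<open>U\<close> of the parity of \<open>n\<close>. Some such
  \<open>i\<close> exists as \<open>D n\<close> is nonempty, and \<open>D i + D n\<close> is the sum
  over the other \<open>j\<close>, whose keys avoid the four indices.\<close>

lemma dependent_walk_eqn:
  assumes "x n \<in> vectors b c" "x (Suc n) \<in> vectors b c" "x n \<noteq> x (Suc n)"
    and "in_span (walk_eqn c x) n (walk_eqn c x n)"
  shows "\<exists>i. Suc i < n \<and>
    sym_diff (key_diff c (x i) (x (Suc i))) (key_diff c (x n) (x (Suc n)))
      \<in> small_combinations c ({..Suc n} - {i, Suc i, n, Suc n}) x"
proof -
  define D where "D i = key_diff c (x i) (x (Suc i))" for i
  obtain U where U: "U \<subseteq> {..<n}" "walk_eqn c x n = {p. odd (card {i\<in>U. p \<in> walk_eqn c x i})}"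
    using assms(4) unfolding in_span_def by blast
  define V where "V = {i\<in>U. i mod 2 = n mod 2}"
  have D: "q \<in> D n \<longleftrightarrow> odd (card {i\<in>V. q \<in> D i})" for q
  proof -
    have "q \<in> D n \<longleftrightarrow> (n mod 2, q) \<in> walk_eqn c x n" by (simp add: walk_eqn_def link_def D_def)
    also have "\<dots> \<longleftrightarrow> odd (card {i\<in>U. (n mod 2, q) \<in> walk_eqn c x i})" by (subst U(2)) simp
    also have "{i\<in>U. (n mod 2, q) \<in> walk_eqn c x i} = {i\<in>V. q \<in> D i}"
      by (auto simp: walk_eqn_def link_def D_def V_def)
    finally show ?thesis .
  qed
  have "D n \<noteq> {}" unfolding D_def using assms(1-3) by (rule key_diff_nonempty)
  then obtain q where "q \<in> D n" by blast
  then have "{i\<in>V. q \<in> D i} \<noteq> {}" using D[of q] by (metis card.empty even_zero)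
  then obtain i where i: "i \<in> V" by blast
  \<comment> \<open>Different indices of equal parity are at least two apart, so their index pairs
    \<open>j\<close>, \<open>Suc j\<close> are disjoint.\<close>
  have V: "Suc j < n \<and> j mod 2 = n mod 2" if "j \<in> V" for j
  proof -
    have "j < n" "j mod 2 = n mod 2" using that U(1) by (auto simp: V_def)
    then show ?thesis by presburger
  qed
  have "sym_diff (D i) (D n) \<subseteq> (\<Union>l\<in>{..Suc n} - {i, Suc i, n, Suc n}. (\<lambda>k. (k, x l k)) ` {..<c})"
  proof
    fix q assume q: "q \<in> sym_diff (D i) (D n)"
    have "\<exists>j\<in>V - {i}. q \<in> D j"
    proof (rule ccontr)
      assume "\<not> ?thesis"
      then have "{j\<in>V. q \<in> D j} = (if q \<in> D i then {i} else {})" using i by auto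
      then have "q \<in> D n \<longleftrightarrow> q \<in> D i" using D[of q] by simp
      then show False using q by blast
    qed
    then obtain j where j: "j \<in> V" "j \<noteq> i" "q \<in> D j" by blast
    have "j \<noteq> Suc i" "Suc j \<noteq> i" using V[OF i] V[OF j(1)] by presburger+
    then have "j \<in> {..Suc n} - {i, Suc i, n, Suc n}" "Suc j \<in> {..Suc n} - {i, Suc i, n, Suc n}"
      using V[OF j(1)] j(2) by auto
    moreover have "q \<in> (\<lambda>k. (k, x j k)) ` {..<c} \<or> q \<in> (\<lambda>k. (k, x (Suc j) k)) ` {..<c}"
      using j(3) key_diff_entries unfolding D_def by blast
    ultimately show "q \<in> (\<Union>l\<in>{..Suc n} - {i, Suc i, n, Suc n}. (\<lambda>k. (k, x l k)) ` {..<c})"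
      by (meson UN_I)
  qed
  moreover have "card (sym_diff (D i) (D n)) \<le> 4 * c"
  proof -
    have le: "finite (D j) \<and> card (D j) \<le> 2 * c" for j
    proof
      let ?E = "(\<lambda>k. (k, x j k)) ` {..<c} \<union> (\<lambda>k. (k, x (Suc j) k)) ` {..<c}"
      have sub: "D j \<subseteq> ?E" unfolding D_def by (rule key_diff_entries)
      then show "finite (D j)" by (rule finite_subset) simp
      have "card (D j) \<le> card ?E" using sub by (intro card_mono) auto
      also have "\<dots> \<le> card {..<c} + card {..<c}"
        by (intro order_trans[OF card_Un_le] add_mono card_image_le) auto
      finally show "card (D j) \<le> 2 * c" by simp
    qed
    have "card (sym_diff (D i) (D n)) \<le> card (D i \<union> D n)" using le by (intro card_mono) auto
    also have "\<dots> \<le> card (D i) + card (D n)" by (rule card_Un_le)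
    finally show ?thesis using le[of i] le[of n] by linarith
  qed
  ultimately show ?thesis using V[OF i] unfolding small_combinations_def D_def by blast
qed

lemma card_small_subsets_le:
  assumes "finite M"
  shows "card {v. v \<subseteq> M \<and> card v \<le> k} \<le> (k + 1) * (card M + 1) ^ k"
proof -
  have le: "card {v. v \<subseteq> M \<and> card v = j} \<le> (card M + 1) ^ k" if "j \<le> k" for j
  proof (cases "j \<le> card M")
    case True
    have "card {v. v \<subseteq> M \<and> card v = j} = card M choose j" by (rule n_subsets[OF assms])
    also have "\<dots> \<le> card M ^ j" by (rule binomial_le_pow[OF True])
    also have "\<dots> \<le> (card M + 1) ^ j" by (rule power_mono) auto
    also have "\<dots> \<le> (card M + 1) ^ k" using that by (intro power_increasing) auto
    finally show ?thesis .
  next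
    case False
    then show ?thesis using n_subsets[OF assms, of j] by (simp add: binomial_eq_0)
  qed
  have "{v. v \<subseteq> M \<and> card v \<le> k} = (\<Union>j\<in>{..k}. {v. v \<subseteq> M \<and> card v = j})" by auto
  also have "card \<dots> \<le> (\<Sum>j\<in>{..k}. card {v. v \<subseteq> M \<and> card v = j})" by (rule card_UN_le) simp
  also have "\<dots> \<le> (\<Sum>j\<in>{..k}. (card M + 1) ^ k)" by (intro sum_mono le) simp
  finally show ?thesis by simp
qed

text \<open>The factors bound the choices of \<open>i\<close> in \<open>dependent_walk_eqn\<close>,
  the candidate sums made from at most \<open>n\<close> keys, and the constant of
  \<open>card_four_sums_le\<close>.\<close>

definition walk_bound :: "nat \<Rightarrow> nat \<Rightarrow> nat" where
  "walk_bound c n = n * ((4 * c + 1) * (n * c + 1) ^ (4 * c) * 4 ^ c)"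

definition dependent_walks :: "nat \<Rightarrow> (nat \<Rightarrow> nat) set \<Rightarrow> nat \<Rightarrow> (nat \<Rightarrow> nat \<Rightarrow> nat) set" where
  "dependent_walks c S n = {x \<in> {..Suc n} \<rightarrow>\<^sub>E S. x n \<noteq> x (Suc n) \<and>
     in_span (walk_eqn c x) n (walk_eqn c x n)}"

lemma card_small_combinations_le:
  assumes "finite I" "card I \<le> n"
  shows "finite (small_combinations c I x)"
    and "card (small_combinations c I x) \<le> (4 * c + 1) * (n * c + 1) ^ (4 * c)"
proof -
  let ?M = "\<Union>l\<in>I. (\<lambda>k. (k, x l k)) ` {..<c}"
  have fin: "finite ?M" using assms(1) by simp
  then show "finite (small_combinations c I x)"
    unfolding small_combinations_def by (auto intro: finite_subset[of _ "Pow ?M"])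
  have "card ?M \<le> (\<Sum>l\<in>I. card ((\<lambda>k. (k, x l k)) ` {..<c}))" by (rule card_UN_le[OF assms(1)])
  also have "\<dots> \<le> (\<Sum>l\<in>I. c)" by (intro sum_mono order_trans[OF card_image_le]) auto
  also have "\<dots> \<le> n * c" using assms(2) by simp
  finally have "(card ?M + 1) ^ (4 * c) \<le> (n * c + 1) ^ (4 * c)" by (intro power_mono) auto
  then show "card (small_combinations c I x) \<le> (4 * c + 1) * (n * c + 1) ^ (4 * c)"
    unfolding small_combinations_def
    by (intro order_trans[OF card_small_subsets_le[OF fin]] mult_mono) auto
qed

text \<open>Of the \<open>n + 2\<close> keys, the \<open>n - 2\<close> outside the four special
  indices are free. They leave polynomially many candidate sums, and each sum admits only
  \<open>O(card S ^ 2)\<close> quadruples. This saves two powers of \<open>card S\<close>.\<close>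

lemma card_dependent_walks_le:
  assumes "finite S" "S \<subseteq> vectors b c"
  shows "card (dependent_walks c S n) \<le> walk_bound c n * card S ^ n"
proof -
  define quad where "quad i x = ((x i, x (Suc i)), (x n, x (Suc n)))" for i and x :: "nat \<Rightarrow> nat \<Rightarrow> nat"
  define Q where "Q v = {((x, y), (z, w)) \<in> (S \<times> S) \<times> (S \<times> S).
    sym_diff (key_diff c x y) (key_diff c z w) = v}" for v
  define I where "I i = {..Suc n} - {i, Suc i, n, Suc n}" for i
  define A where "A i = {x \<in> {..Suc n} \<rightarrow>\<^sub>E S. \<exists>v\<in>small_combinations c (I i) x. quad i x \<in> Q v}" for i
  define K where "K = (4 * c + 1) * (n * c + 1) ^ (4 * c)"
  have finQ: "finite (Q v)" for v
    by (rule finite_subset[of _ "(S \<times> S) \<times> (S \<times> S)"]) (use assms(1) in \<open>auto simp: Q_def\<close>)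
  have A: "card (A i) \<le> K * 4 ^ c * card S ^ n" if i: "Suc i < n" for i
  proof -
    have finI: "finite (I i)" by (simp add: I_def)
    have "card {i, Suc i, n, Suc n} = 4" using i by auto
    then have cardI: "card (I i) = n - 2"
      using i unfolding I_def by (subst card_Diff_subset) auto
    \<comment> \<open>The free keys \<open>r\<close> come first, since the candidate sums for the
      quadruple are computed from them.\<close>
    define B where "B = (SIGMA r:(I i \<rightarrow>\<^sub>E S). \<Union>v\<in>small_combinations c (I i) r. Q v)"
    define F where "F x = (restrict x (I i), quad i x)" for x
    have "inj_on F (A i)"
    proof (rule inj_onI)
      fix x y assume xy: "x \<in> A i" "y \<in> A i" "F x = F y"
      show "x = y"
      proof (rule PiE_ext[of _ "{..Suc n}" "\<lambda>_. S"])
        fix k assume "k \<in> {..Suc n}"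
        then consider "k \<in> I i" | "k \<in> {i, Suc i, n, Suc n}" unfolding I_def by blast
        then show "x k = y k"
        proof cases
          case 1
          have "restrict x (I i) k = restrict y (I i) k" using xy(3) by (simp add: F_def)
          then show ?thesis using 1 by simp
        next
          case 2 then show ?thesis using xy(3) by (auto simp: F_def quad_def)
        qed
      qed (use xy in \<open>auto simp: A_def\<close>)
    qed
    moreover have "F ` A i \<subseteq> B"
    proof (rule image_subsetI)
      fix x assume x: "x \<in> A i"
      have "small_combinations c (I i) (restrict x (I i)) = small_combinations c (I i) x"
        by (simp add: small_combinations_def)
      moreover have "restrict x (I i) \<in> I i \<rightarrow>\<^sub>E S"
      proof (rule restrict_PiE_iff[THEN iffD2], rule ballI)
        fix k assume "k \<in> I i"
        then have "k \<in> {..Suc n}" unfolding I_def by blast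
        then show "x k \<in> S" using x unfolding A_def by blast
      qed
      moreover obtain v where "v \<in> small_combinations c (I i) x" "quad i x \<in> Q v"
        using x unfolding A_def by blast
      ultimately show "F x \<in> B" unfolding B_def F_def by auto
    qed
    moreover have finB: "finite B"
      unfolding B_def using finI assms(1) card_small_combinations_le(1)[OF finI order_refl] finQ
      by (intro finite_SigmaI finite_UN_I finite_PiE) auto
    ultimately have "card (A i) \<le> card B" by (intro card_inj_on_le)
    also have "card B = (\<Sum>r\<in>I i \<rightarrow>\<^sub>E S. card (\<Union>v\<in>small_combinations c (I i) r. Q v))"
      unfolding B_def using finI assms(1) card_small_combinations_le(1)[OF finI order_refl] finQ
      by (intro card_SigmaI) (auto intro: finite_PiE)
    also have "\<dots> \<le> (\<Sum>r\<in>I i \<rightarrow>\<^sub>E S. K * (4 ^ c * card S ^ 2))"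
    proof (rule sum_mono)
      fix r
      have "card (\<Union>v\<in>small_combinations c (I i) r. Q v)
          \<le> (\<Sum>v\<in>small_combinations c (I i) r. card (Q v))"
        by (rule card_UN_le[OF card_small_combinations_le(1)[OF finI order_refl]])
      also have "\<dots> \<le> (\<Sum>v\<in>small_combinations c (I i) r. 4 ^ c * card S ^ 2)"
        unfolding Q_def by (rule sum_mono) (rule card_four_sums_le[OF assms])
      also have "\<dots> = card (small_combinations c (I i) r) * (4 ^ c * card S ^ 2)" by simp
      also have "\<dots> \<le> K * (4 ^ c * card S ^ 2)"
        unfolding K_def using cardI by (intro mult_right_mono card_small_combinations_le(2)[OF finI]) auto
      finally show "card (\<Union>v\<in>small_combinations c (I i) r. Q v) \<le> K * (4 ^ c * card S ^ 2)" .
    qed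
    also have "\<dots> = card S ^ (n - 2) * (K * (4 ^ c * card S ^ 2))"
      using finI cardI by (simp add: card_PiE)
    also have "\<dots> = K * 4 ^ c * (card S ^ (n - 2) * card S ^ 2)" by (simp only: ac_simps)
    \<comment> \<open>The subtraction is exact because \<open>Suc i < n\<close> forces
      \<open>n\<close> to be at least 2.\<close>
    also have "card S ^ (n - 2) * card S ^ 2 = card S ^ n"
      unfolding power_add[symmetric] using i by (intro arg_cong[of _ _ "\<lambda>k. card S ^ k"]) simp
    finally show ?thesis .
  qed
  have finA: "finite (A i)" for i
    by (rule finite_subset[of _ "{..Suc n} \<rightarrow>\<^sub>E S"]) (use assms(1) in \<open>auto simp: A_def intro: finite_PiE\<close>)
  have "dependent_walks c S n \<subseteq> (\<Union>i\<in>{i. Suc i < n}. A i)"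
  proof
    fix x assume "x \<in> dependent_walks c S n"
    then have x: "x \<in> {..Suc n} \<rightarrow>\<^sub>E S" "x n \<noteq> x (Suc n)" "in_span (walk_eqn c x) n (walk_eqn c x n)"
      by (auto simp: dependent_walks_def)
    have xS: "x k \<in> S" if "k \<le> Suc n" for k using x(1) that by auto
    obtain i where i: "Suc i < n" "sym_diff (key_diff c (x i) (x (Suc i))) (key_diff c (x n) (x (Suc n)))
        \<in> small_combinations c (I i) x"
      using dependent_walk_eqn[of x n b c] xS[of n] xS[of "Suc n"] assms(2) x unfolding I_def by auto
    have "quad i x \<in> Q (sym_diff (key_diff c (x i) (x (Suc i))) (key_diff c (x n) (x (Suc n))))"
      unfolding Q_def quad_def using i(1) xS by simp
    then have "x \<in> A i" unfolding A_def using i(2) x(1) by blast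
    then show "x \<in> (\<Union>i\<in>{i. Suc i < n}. A i)" using i(1) by blast
  qed
  moreover have fin: "finite {i. Suc i < n}" by (rule finite_subset[of _ "{..<n}"]) auto
  ultimately have "card (dependent_walks c S n) \<le> card (\<Union>i\<in>{i. Suc i < n}. A i)"
    using finA by (intro card_mono) auto
  also have "\<dots> \<le> (\<Sum>i\<in>{i. Suc i < n}. card (A i))" by (rule card_UN_le[OF fin])
  also have "\<dots> \<le> (\<Sum>i\<in>{i. Suc i < n}. K * 4 ^ c * card S ^ n)" by (rule sum_mono) (simp add: A)
  also have "\<dots> = card {i. Suc i < n} * (K * 4 ^ c * card S ^ n)" by simp
  also have "card {i. Suc i < n} \<le> card {..<n}" by (intro card_mono) auto
  finally show ?thesis by (simp add: walk_bound_def K_def mult.assoc)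
qed

section \<open>The expected size of the 2-core\<close>

text \<open>
  An element \<open>(e, k, a)\<close> of the domain of \<open>T\<close> is the entry for character \<open>a\<close> of table \<open>k\<close> at
  side \<open>e\<close> of the bipartite graph.
\<close>

definition edge_core ::
    "nat \<Rightarrow> (nat \<Rightarrow> nat) set \<Rightarrow> (nat \<times> nat \<times> nat \<Rightarrow> nat) \<Rightarrow> (nat \<Rightarrow> nat) \<Rightarrow> bool" where
  "edge_core c S T x \<longleftrightarrow> (\<exists>Y\<subseteq>S. x \<in> Y \<and>
     (\<forall>y\<in>Y. \<forall>e<2. \<exists>y'\<in>Y. y' \<noteq> y \<and> annihilates T (link c e y y')))"

definition entries :: "nat \<Rightarrow> nat \<Rightarrow> (nat \<times> nat \<times> nat) set" where
  "entries b c = {..<2} \<times> {..<c} \<times> alphabet b"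

lemma finite_entries: "finite (entries b c)"
  by (simp add: entries_def alphabet_def)

lemma link_subset_entries:
  assumes "x \<in> vectors b c" "y \<in> vectors b c" "e < 2"
  shows "link c e x y \<subseteq> entries b c"
  using assms by (auto simp: link_def entries_def key_diff_def vectors_def)

text \<open>Inside the witness \<open>Y\<close> every edge has another edge at the prescribed side,
  so the walk never gets stuck. Keys may recur.\<close>

lemma edge_core_walk:
  assumes "edge_core c S T x0"
  shows "\<exists>x. x 0 = x0 \<and> (\<forall>i. x i \<in> S \<and> x i \<noteq> x (Suc i) \<and> annihilates T (walk_eqn c x i))"
proof -
  obtain Y where Y: "Y \<subseteq> S" "x0 \<in> Y"
    "\<And>y e. y \<in> Y \<Longrightarrow> e < 2 \<Longrightarrow> \<exists>y'\<in>Y. y' \<noteq> y \<and> annihilates T (link c e y y')"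
    using assms unfolding edge_core_def by blast
  have "\<exists>x. \<forall>i. (x i \<in> Y \<and> (i = 0 \<longrightarrow> x i = x0)) \<and>
      (x i \<noteq> x (Suc i) \<and> annihilates T (link c (i mod 2) (x i) (x (Suc i))))"
  proof (rule dependent_nat_choice)
    show "\<exists>y. y \<in> Y \<and> ((0::nat) = 0 \<longrightarrow> y = x0)" using Y(2) by blast
  next
    fix y and i :: nat assume "y \<in> Y \<and> (i = 0 \<longrightarrow> y = x0)"
    then obtain y' where "y' \<in> Y" "y' \<noteq> y" "annihilates T (link c (i mod 2) y y')"
      using Y(3)[of y "i mod 2"] by auto
    then show "\<exists>y'. (y' \<in> Y \<and> (Suc i = 0 \<longrightarrow> y' = x0)) \<and>
        (y \<noteq> y' \<and> annihilates T (link c (i mod 2) y y'))" by auto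
  qed
  then show ?thesis unfolding walk_eqn_def using Y(1) by blast
qed

lemma in_span_cong:
  assumes "\<And>i. i < n \<Longrightarrow> E i = E' i"
  shows "in_span E n v \<longleftrightarrow> in_span E' n v"
proof -
  have "{i\<in>U. p \<in> E i} = {i\<in>U. p \<in> E' i}" if "U \<subseteq> {..<n}" for U p
    using assms that by auto
  then show ?thesis unfolding in_span_def by (simp cong: conj_cong)
qed

text \<open>Infinite walks are counted through their initial segments as extensional functions;
  equation \<open>i\<close> reads only keys \<open>i\<close> and \<open>Suc i\<close>.\<close>

lemma walk_eqn_restrict: "i < n \<Longrightarrow> walk_eqn c (restrict x {..n}) i = walk_eqn c x i"
  by (simp add: walk_eqn_def)

definition independent_walk :: "nat \<Rightarrow> (nat \<Rightarrow> nat \<Rightarrow> nat) \<Rightarrow> nat \<Rightarrow> bool" where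
  "independent_walk c x n \<longleftrightarrow> (\<forall>i<n. \<not> in_span (walk_eqn c x) i (walk_eqn c x i))"

lemma independent_walk_restrict:
  assumes "n \<le> m"
  shows "independent_walk c (restrict x {..m}) n \<longleftrightarrow> independent_walk c x n"
proof -
  have "in_span (walk_eqn c (restrict x {..m})) i v \<longleftrightarrow> in_span (walk_eqn c x) i v" if "i < n" for i v
    using assms that by (intro in_span_cong walk_eqn_restrict) simp
  moreover have "walk_eqn c (restrict x {..m}) i = walk_eqn c x i" if "i < n" for i
    using assms that by (intro walk_eqn_restrict) simp
  ultimately show ?thesis by (simp add: independent_walk_def)
qed

definition walk_tables ::
    "nat \<Rightarrow> nat \<Rightarrow> (nat \<Rightarrow> nat \<Rightarrow> nat) \<Rightarrow> nat \<Rightarrow> (nat \<times> nat \<times> nat \<Rightarrow> nat) set" where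
  "walk_tables b c x n = {T \<in> entries b c \<rightarrow>\<^sub>E alphabet b. \<forall>i<n. annihilates T (walk_eqn c x i)}"

lemma walk_tables_restrict: "n \<le> m \<Longrightarrow> walk_tables b c (restrict x {..m}) n = walk_tables b c x n"
  by (auto simp: walk_tables_def walk_eqn_restrict)

lemma finite_tables: "finite (entries b c \<rightarrow>\<^sub>E alphabet b)"
  by (intro finite_PiE finite_entries) (simp add: alphabet_def)

lemma card_walk_tables_le:
  assumes "\<And>i. i \<le> n \<Longrightarrow> x i \<in> vectors b c" "independent_walk c x n"
  shows "real (card (walk_tables b c x n)) \<le> card (entries b c \<rightarrow>\<^sub>E alphabet b) / (2 ^ b) ^ n"
proof -
  have "card (walk_tables b c x n) * (2 ^ b) ^ n \<le> card (entries b c \<rightarrow>\<^sub>E alphabet b)"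
    unfolding walk_tables_def
  proof (rule card_annihilators_le)
    show "walk_eqn c x i \<subseteq> entries b c" if "i < n" for i
      unfolding walk_eqn_def using that assms(1) by (intro link_subset_entries) auto
    show "\<not> in_span (walk_eqn c x) i (walk_eqn c x i)" if "i < n" for i
      using assms(2) that by (simp add: independent_walk_def)
  qed (rule finite_entries)
  then have "real (card (walk_tables b c x n)) * (2 ^ b) ^ n \<le> card (entries b c \<rightarrow>\<^sub>E alphabet b)"
    unfolding of_nat_le_iff[where 'a = real, symmetric] by simp
  then show ?thesis by (simp add: pos_le_divide_eq)
qed

text \<open>Pairs of a key and a table with the key in the core are covered by walks starting at
  that key. Either the first dependent equation has some index \<open>n < J\<close>, which gives the
  term with \<open>walk_bound c n\<close>, or the first \<open>J\<close> equations are
  independent.\<close>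

lemma sum_edge_core_le_truncated:
  fixes b c J :: nat and q :: real
  assumes "finite S" "S \<subseteq> vectors b c"
  defines "q \<equiv> card S / 2 ^ b"
  shows "(\<Sum>x\<in>S. real (card {T \<in> entries b c \<rightarrow>\<^sub>E alphabet b. edge_core c S T x}))
    \<le> card (entries b c \<rightarrow>\<^sub>E alphabet b) * (card S * q ^ J + (\<Sum>n<J. walk_bound c n * q ^ n))"
proof -
  define \<Omega> where "\<Omega> = entries b c \<rightarrow>\<^sub>E alphabet b"
  define L where "L = {x \<in> {..J} \<rightarrow>\<^sub>E S. independent_walk c x J}"
  define W where "W n = {x \<in> dependent_walks c S n. independent_walk c x n}" for n
  define B where "B = (\<Union>x\<in>L. {x 0} \<times> walk_tables b c x J)"
  define B' where "B' n = (\<Union>x\<in>W n. {x 0} \<times> walk_tables b c x n)" for n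
  have fin\<Omega>: "finite \<Omega>" unfolding \<Omega>_def by (rule finite_tables)
  have finT: "finite (walk_tables b c x n)" for x n
    unfolding walk_tables_def using finite_tables by simp
  have finL: "finite L" unfolding L_def using assms(1) by (simp add: finite_PiE)
  have finD: "finite (dependent_walks c S n)" for n
    unfolding dependent_walks_def using assms(1) by (simp add: finite_PiE)
  then have finW: "finite (W n)" for n by (simp add: W_def)
  have sub: "(SIGMA x:S. {T \<in> \<Omega>. edge_core c S T x}) \<subseteq> B \<union> (\<Union>n\<in>{..<J}. B' n)"
  proof (clarify)
    fix x0 T assume T: "T \<in> \<Omega>" "edge_core c S T x0" and not: "(x0, T) \<notin> (\<Union>n\<in>{..<J}. B' n)"
    obtain x where x: "x 0 = x0" "\<And>i. x i \<in> S" "\<And>i. x i \<noteq> x (Suc i)"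
        "\<And>i. annihilates T (walk_eqn c x i)"
      using edge_core_walk[OF T(2)] by blast
    have Tin: "T \<in> walk_tables b c x n" for n
      using T(1) x(4) by (simp add: walk_tables_def \<Omega>_def)
    \<comment> \<open>If equation \<open>n\<close> were the first dependent one, the segment up to
      \<open>Suc n\<close> would put the pair into the excluded set \<open>B' n\<close>.\<close>
    have "independent_walk c x n" if "n \<le> J" for n
      using that
    proof (induction n)
      case (Suc n)
      have "\<not> in_span (walk_eqn c x) n (walk_eqn c x n)"
      proof
        assume dep: "in_span (walk_eqn c x) n (walk_eqn c x n)"
        let ?x = "restrict x {..Suc n}"
        have "walk_eqn c ?x n = walk_eqn c x n" by (intro walk_eqn_restrict) simp
        moreover have "in_span (walk_eqn c ?x) n v \<longleftrightarrow> in_span (walk_eqn c x) n v" for v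
          by (intro in_span_cong walk_eqn_restrict) simp
        ultimately have "?x \<in> dependent_walks c S n"
          using dep x unfolding dependent_walks_def by auto
        moreover have "independent_walk c ?x n"
          using Suc by (subst independent_walk_restrict) auto
        ultimately have "?x \<in> W n" by (simp add: W_def)
        moreover have "T \<in> walk_tables b c ?x n"
          using Tin by (subst walk_tables_restrict) auto
        ultimately have "(?x 0, T) \<in> B' n" unfolding B'_def by blast
        then show False using not Suc.prems x(1) by auto
      qed
      then show ?case using Suc by (auto simp: independent_walk_def less_Suc_eq)
    qed (simp add: independent_walk_def)
    then have "independent_walk c x J" by simp
    then have "restrict x {..J} \<in> L"
      unfolding L_def using x(2) by (simp add: independent_walk_restrict)
    moreover have "T \<in> walk_tables b c (restrict x {..J}) J"
      using Tin by (subst walk_tables_restrict) auto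
    ultimately have "(restrict x {..J} 0, T) \<in> B" unfolding B_def by blast
    then show "(x0, T) \<in> B" using x(1) by simp
  qed
  have tables: "real (card ({x 0} \<times> walk_tables b c x n)) \<le> card \<Omega> / (2 ^ b) ^ n"
    if "\<And>i. i \<le> n \<Longrightarrow> x i \<in> S" "independent_walk c x n" for x n
    using card_walk_tables_le[of n x b c] that assms(2) unfolding \<Omega>_def
    by (auto simp: card_cartesian_product)
  have "real (card B) \<le> (\<Sum>x\<in>L. real (card ({x 0} \<times> walk_tables b c x J)))"
    unfolding B_def of_nat_sum[symmetric] by (intro of_nat_mono card_UN_le finL)
  also have "\<dots> \<le> (\<Sum>x\<in>L. card \<Omega> / (2 ^ b) ^ J)"
    by (intro sum_mono tables) (auto simp: L_def)
  also have "\<dots> = card L * (card \<Omega> / (2 ^ b) ^ J)" by simp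
  \<comment> \<open>A segment of \<open>J + 1\<close> keys carries only \<open>J\<close> equations,
    which leaves one factor \<open>card S\<close>.\<close>
  also have "card L \<le> card ({..J} \<rightarrow>\<^sub>E S)"
    unfolding L_def using assms(1) by (intro card_mono) (auto simp: finite_PiE)
  also have "card ({..J} \<rightarrow>\<^sub>E S) = card S * card S ^ J" by (simp add: card_PiE)
  finally have B: "real (card B) \<le> card \<Omega> * (card S * q ^ J)"
    by (simp add: q_def power_divide mult_ac mult_right_mono divide_right_mono)
  have B': "real (card (B' n)) \<le> card \<Omega> * (walk_bound c n * q ^ n)" for n
  proof -
    have "real (card (B' n)) \<le> (\<Sum>x\<in>W n. real (card ({x 0} \<times> walk_tables b c x n)))"
      unfolding B'_def of_nat_sum[symmetric] by (intro of_nat_mono card_UN_le finW)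
    also have "\<dots> \<le> (\<Sum>x\<in>W n. card \<Omega> / (2 ^ b) ^ n)"
      by (intro sum_mono tables) (auto simp: W_def dependent_walks_def)
    also have "\<dots> = card (W n) * (card \<Omega> / (2 ^ b) ^ n)" by simp
    also have "\<dots> \<le> real (walk_bound c n * card S ^ n) * (card \<Omega> / (2 ^ b) ^ n)"
    proof (intro mult_right_mono of_nat_mono)
      have "card (W n) \<le> card (dependent_walks c S n)"
        using finD by (intro card_mono) (auto simp: W_def)
      then show "card (W n) \<le> walk_bound c n * card S ^ n"
        using card_dependent_walks_le[OF assms(1,2), of n] by linarith
    qed simp
    also have "\<dots> = card \<Omega> * (walk_bound c n * q ^ n)"
      by (simp add: q_def power_divide)
    finally show ?thesis .
  qed
  have finB: "finite B" "finite (B' n)" for n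
    unfolding B_def B'_def using finL finW finT by auto
  have "(\<Sum>x\<in>S. real (card {T \<in> \<Omega>. edge_core c S T x})) = card (SIGMA x:S. {T \<in> \<Omega>. edge_core c S T x})"
    using assms(1) fin\<Omega> by simp
  also have "\<dots> \<le> card (B \<union> (\<Union>n\<in>{..<J}. B' n))"
    using sub finB by (intro of_nat_mono card_mono) auto
  also have "\<dots> \<le> card B + card (\<Union>n\<in>{..<J}. B' n)"
    by (intro of_nat_mono card_Un_le)
  also have "\<dots> \<le> real (card B) + (\<Sum>n<J. real (card (B' n)))"
    unfolding of_nat_sum[symmetric] of_nat_add[symmetric] by (intro of_nat_mono add_left_mono card_UN_le) simp
  also have "\<dots> \<le> card \<Omega> * (card S * q ^ J) + (\<Sum>n<J. card \<Omega> * (walk_bound c n * q ^ n))"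
    by (intro add_mono sum_mono B B')
  finally show ?thesis by (simp add: \<Omega>_def distrib_left sum_distrib_left)
qed

section \<open>Summation over all walk lengths\<close>

lemma summable_power_geometric:
  fixes x :: real
  assumes "\<bar>x\<bar> < 1"
  shows "summable (\<lambda>n. real (Suc n) ^ k * x ^ n)"
  using assms
proof (induction k arbitrary: x)
  case 0
  then show ?case by (simp add: summable_geometric)
next
  case (Suc k)
  have "summable (\<lambda>n. real n ^ k * y ^ n)" if "norm y < 1" for y :: real
  proof -
    have "summable (\<lambda>n. y * (real (Suc n) ^ k * y ^ n))"
      using Suc.IH[of y] that by (intro summable_mult) simp
    then have "summable (\<lambda>n. real (Suc n) ^ k * y ^ Suc n)" by (simp only: power_Suc mult.left_commute)
    then show ?thesis by (simp only: summable_Suc_iff[of "\<lambda>n. real n ^ k * y ^ n"])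
  qed
  \<comment> \<open>Termwise differentiation of the series with coefficients \<open>n ^ k\<close>
    produces the coefficients \<open>Suc n ^ Suc k\<close>.\<close>
  then have "summable (\<lambda>n. diffs (\<lambda>n. real n ^ k) n * x ^ n)"
    using Suc.prems by (intro termdiff_converges[where K = 1]) auto
  then show ?case by (simp only: diffs_def power_Suc)
qed

lemma summable_walk_bound:
  assumes "0 \<le> r" "r < 1"
  shows "summable (\<lambda>n. real (walk_bound c (Suc n)) * r ^ n)"
proof (rule summable_comparison_test')
  let ?K = "(4 * c + 1) * (c + 1) ^ (4 * c) * 4 ^ c"
  show "summable (\<lambda>n. real ?K * (real (Suc n) ^ Suc (4 * c) * r ^ n))"
    using assms by (intro summable_mult summable_power_geometric) simp
  fix n
  have "(Suc n * c + 1) ^ (4 * c) \<le> ((c + 1) * Suc n) ^ (4 * c)"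
    by (intro power_mono) (simp_all add: algebra_simps)
  then have "walk_bound c (Suc n) \<le> Suc n * ((4 * c + 1) * ((c + 1) * Suc n) ^ (4 * c) * 4 ^ c)"
    unfolding walk_bound_def by (intro mult_mono order_refl) auto
  also have "\<dots> = ?K * Suc n ^ Suc (4 * c)" by (simp only: power_mult_distrib power_Suc ac_simps)
  finally have "real (walk_bound c (Suc n)) \<le> real ?K * real (Suc n) ^ Suc (4 * c)"
    unfolding of_nat_power[symmetric] of_nat_mult[symmetric] of_nat_le_iff .
  then have "real (walk_bound c (Suc n)) * r ^ n \<le> real ?K * real (Suc n) ^ Suc (4 * c) * r ^ n"
    using assms(1) by (intro mult_right_mono) auto
  then show "norm (real (walk_bound c (Suc n)) * r ^ n) \<le> real ?K * (real (Suc n) ^ Suc (4 * c) * r ^ n)"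
    using assms(1) by (simp only: real_norm_def abs_mult power_abs abs_of_nat abs_of_nonneg mult.assoc)
qed

text \<open>The shifted index takes one factor out of the series of
  \<open>walk_bound c n * r ^ n\<close>, whose term at 0 vanishes. That factor becomes
  \<open>card S / 2 ^ b\<close> in the bound on the core.\<close>

definition core_const :: "nat \<Rightarrow> real \<Rightarrow> real" where
  "core_const c r = (\<Sum>n. real (walk_bound c (Suc n)) * r ^ n)"

text \<open>The left side does not depend on \<open>J\<close>, and \<open>card S * q ^ J\<close>
  tends to 0 because \<open>q \<le> r < 1\<close>.\<close>

lemma sum_edge_core_le:
  fixes r :: real
  assumes "finite S" "S \<subseteq> vectors b c" "card S \<le> r * 2 ^ b" "0 \<le> r" "r < 1"
  shows "(\<Sum>x\<in>S. real (card {T \<in> entries b c \<rightarrow>\<^sub>E alphabet b. edge_core c S T x}))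
    \<le> card (entries b c \<rightarrow>\<^sub>E alphabet b) * (core_const c r * (card S / 2 ^ b))" (is "?L \<le> ?\<Omega> * _")
proof -
  define q where "q = card S / 2 ^ b"
  have q: "0 \<le> q" "q \<le> r" using assms(3) by (simp_all add: q_def divide_le_eq)
  have lim: "(\<lambda>J. q ^ J) \<longlonglongrightarrow> 0" using q assms(5) by (intro LIMSEQ_power_zero) simp
  have walks: "(\<Sum>n<J. walk_bound c n * q ^ n) \<le> core_const c r * q" for J
  proof -
    \<comment> \<open>One more term is added so that the index shift leaves exactly \<open>J\<close>
      terms.\<close>
    have "(\<Sum>n<J. walk_bound c n * q ^ n) \<le> (\<Sum>n<Suc J. walk_bound c n * q ^ n)"
      using q(1) by simp
    also have "\<dots> = q * (\<Sum>n<J. walk_bound c (Suc n) * q ^ n)"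
      unfolding sum.lessThan_Suc_shift sum_distrib_left by (simp add: walk_bound_def mult_ac)
    also have "\<dots> \<le> q * (\<Sum>n<J. walk_bound c (Suc n) * r ^ n)"
      using q by (intro mult_left_mono sum_mono power_mono) auto
    also have "\<dots> \<le> q * core_const c r"
      unfolding core_const_def using q(1) assms(4,5)
      by (intro mult_left_mono sum_le_suminf summable_walk_bound) auto
    finally show ?thesis by (simp add: mult.commute)
  qed
  have "?L \<le> ?\<Omega> * (card S * q ^ J + core_const c r * q)" for J
  proof -
    have "?L \<le> ?\<Omega> * (card S * q ^ J + (\<Sum>n<J. walk_bound c n * q ^ n))"
      unfolding q_def by (rule sum_edge_core_le_truncated[OF assms(1,2)])
    also have "\<dots> \<le> ?\<Omega> * (card S * q ^ J + core_const c r * q)"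
      by (intro mult_left_mono add_left_mono walks) simp
    finally show ?thesis .
  qed
  moreover have "(\<lambda>J. ?\<Omega> * (card S * q ^ J + core_const c r * q)) \<longlonglongrightarrow> ?\<Omega> * (real (card S) * 0 + core_const c r * q)"
    by (intro tendsto_mult tendsto_add tendsto_const lim)
  ultimately have "?L \<le> ?\<Omega> * (real (card S) * 0 + core_const c r * q)"
    by (intro LIMSEQ_le_const) auto
  then show ?thesis by (simp add: q_def)
qed

text \<open>Averaging over \<open>S\<close>: if every key exceeded the bound, the sum in
  \<open>sum_edge_core_le\<close> would be too large.\<close>

lemma exists_light_key:
  fixes r :: real
  assumes "finite S" "S \<noteq> {}" "S \<subseteq> vectors b c" "card S \<le> r * 2 ^ b" "0 \<le> r" "r < 1"
  shows "\<exists>x\<in>S. real (card {T \<in> entries b c \<rightarrow>\<^sub>E alphabet b. edge_core c S T x})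
    \<le> core_const c r / 2 ^ b * card (entries b c \<rightarrow>\<^sub>E alphabet b)" (is "\<exists>x\<in>S. ?f x \<le> ?B")
proof (rule ccontr)
  assume "\<not> ?thesis"
  then have "(\<Sum>x\<in>S. ?B) < (\<Sum>x\<in>S. ?f x)"
    using assms(1,2) by (intro sum_strict_mono) (auto simp: not_le)
  then show False using sum_edge_core_le[OF assms(1,3-6)] by (simp add: mult_ac)
qed

section \<open>Peeling\<close>

text \<open>The start value \<open>a\<close> is arbitrary because splitting off the last index
  \<open>c\<close> absorbs \<open>f c\<close> into it.\<close>

lemma bit_foldr_xor:
  "bit (foldr (\<lambda>i r. f i XOR r) [0..<c] (a :: nat)) n \<longleftrightarrow> odd (card {i. i < c \<and> bit (f i) n}) \<noteq> bit a n"
proof (induction c arbitrary: a)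
  case (Suc c)
  have "{i. i < Suc c \<and> bit (f i) n} =
      (if bit (f c) n then insert c {i. i < c \<and> bit (f i) n} else {i. i < c \<and> bit (f i) n})"
    by (auto simp: less_Suc_eq)
  then show ?case by (auto simp: Suc bit_xor_iff)
qed simp

definition table_pair ::
    "nat \<Rightarrow> nat \<Rightarrow> (nat \<Rightarrow> nat \<Rightarrow> nat \<Rightarrow> nat) \<Rightarrow> nat \<Rightarrow> nat \<times> nat \<times> nat \<Rightarrow> nat" where
  "table_pair b c T p = (\<lambda>(e, k, a)\<in>entries b c. T k a (2 * p + e))"

text \<open>Among the entries read by a key, those with bit \<open>n\<close> set have the parity of
  bit \<open>n\<close> of its hash value. Entries common to both keys cancel in the symmetric
  difference.\<close>

lemma annihilates_link:
  assumes "x \<in> vectors b c" "y \<in> vectors b c" "e < 2" "2 * p + e < d"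
    and eq: "simple_tabulation c d T x (2 * p + e) = simple_tabulation c d T y (2 * p + e)"
  shows "annihilates (table_pair b c T p) (link c e x y)"
  unfolding annihilates_def
proof
  fix n
  define A where "A z = (\<lambda>k. (e, k, z k)) ` {k. k < c \<and> bit (T k (z k) (2 * p + e)) n}" for z :: "nat \<Rightarrow> nat"
  have val: "table_pair b c T p (e, k, z k) = T k (z k) (2 * p + e)" if "k < c" "z \<in> vectors b c" for k z
    using that assms(3) by (auto simp: table_pair_def entries_def vectors_def)
  have cardA: "odd (card (A z)) \<longleftrightarrow> bit (simple_tabulation c d T z (2 * p + e)) n" for z
  proof -
    have "card (A z) = card {k. k < c \<and> bit (T k (z k) (2 * p + e)) n}"
      unfolding A_def by (intro card_image inj_onI) simp
    then show ?thesis using assms(4) by (simp add: simple_tabulation_def bit_foldr_xor)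
  qed
  have "{q \<in> link c e x y. bit (table_pair b c T p q) n} = sym_diff (A x) (A y)"
    using val[OF _ assms(1)] val[OF _ assms(2)]
    by (auto simp: link_def key_diff_def A_def image_iff)
  moreover have "finite (A z)" for z by (simp add: A_def)
  ultimately show "even (card {q \<in> link c e x y. bit (table_pair b c T p q) n})"
    using odd_card_sym_diff[of "A x" "A y"] cardA eq by simp
qed

text \<open>Without unique characters, each key of \<open>Y\<close> shares each output character
  with another key of \<open>Y\<close>, so \<open>Y\<close> itself witnesses the core for both
  positions of the pair.\<close>

lemma edge_core_if_not_peelable:
  assumes "X \<subseteq> vectors b c" "Y \<subseteq> X" "x \<in> Y" "2 * p + 1 < d"
    and "\<And>y. y \<in> Y \<Longrightarrow> \<not> has_unique_output_char d (simple_tabulation c d T) Y y"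
  shows "edge_core c X (table_pair b c T p) x"
  unfolding edge_core_def
proof (intro exI[of _ Y] conjI ballI allI impI)
  fix y and e :: nat assume ye: "y \<in> Y" "e < 2"
  then have j: "2 * p + e < d" using assms(4) by linarith
  then obtain y' where y': "y' \<in> Y" "y' \<noteq> y"
      "simple_tabulation c d T y (2 * p + e) = simple_tabulation c d T y' (2 * p + e)"
    using assms(5)[OF ye(1)] unfolding has_unique_output_char_def by blast
  have "y \<in> vectors b c" "y' \<in> vectors b c" using assms(1,2) ye(1) y'(1) by blast+
  then show "\<exists>y'\<in>Y. y' \<noteq> y \<and> annihilates (table_pair b c T p) (link c e y y')"
    using annihilates_link[OF _ _ ye(2) j y'(3)] y'(1,2) by blast
qed (use assms in auto)

section \<open>Uniform tables and independence of the position pairs\<close>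

definition tables :: "nat \<Rightarrow> nat \<Rightarrow> nat \<Rightarrow> (nat \<Rightarrow> nat \<Rightarrow> nat \<Rightarrow> nat) set" where
  "tables b c d = ({..<c} \<rightarrow>\<^sub>E (alphabet b \<rightarrow>\<^sub>E vectors b d))"

lemma finite_vectors: "finite (vectors b n)"
  by (simp add: vectors_def alphabet_def finite_PiE)

lemma card_tables: "card (tables b c d) = (2 ^ b) ^ (d * 2 ^ b * c)"
  by (simp add: tables_def vectors_def card_PiE alphabet_def power_mult)

lemma finite_table_set: "finite (tables b c d)"
  unfolding tables_def by (intro finite_PiE finite_vectors) (simp_all add: alphabet_def)

lemma random_tables_eq: "random_tables b c d = pmf_of_set (tables b c d)"
proof -
  have "alphabet b \<rightarrow>\<^sub>E vectors b d \<noteq> {}"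
    by (auto simp: vectors_def alphabet_def PiE_eq_empty_iff)
  moreover have "finite (alphabet b \<rightarrow>\<^sub>E vectors b d)"
    by (intro finite_PiE finite_vectors) (simp add: alphabet_def)
  \<comment> \<open>The default \<open>undefined\<close> of \<open>Pi_pmf\<close> is also the value
    of an extensional function off its domain.\<close>
  moreover have "PiE_dflt {..<c} undefined (\<lambda>_. alphabet b \<rightarrow>\<^sub>E vectors b d) = tables b c d"
    by (auto simp: PiE_dflt_def tables_def PiE_def extensional_def)
  ultimately show ?thesis
    unfolding random_tables_def by (subst Pi_pmf_of_set) auto
qed

text \<open>Independence in counting form: the \<open>D\<close> pair tables and the entries at
  positions from \<open>2 * D\<close> on determine \<open>T\<close>, and the cardinality of all
  tables factors accordingly.\<close>

lemma card_table_pairs_le: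
  assumes "A \<subseteq> entries b c \<rightarrow>\<^sub>E alphabet b" "2 * D \<le> d"
  shows "card {T \<in> tables b c d. \<forall>p<D. table_pair b c T p \<in> A} * card (entries b c \<rightarrow>\<^sub>E alphabet b) ^ D
    \<le> card A ^ D * card (tables b c d)" (is "card ?B * _ \<le> _")
proof -
  define R where "R = {..<c} \<times> alphabet b \<times> {2 * D..<d}"
  define F where "F T = ((\<lambda>p\<in>{..<D}. table_pair b c T p), (\<lambda>(k, a, j)\<in>R. T k a j))"
    for T :: "nat \<Rightarrow> nat \<Rightarrow> nat \<Rightarrow> nat"
  have finA: "finite A" using assms(1) finite_tables finite_subset by blast
  have finR: "finite R" by (simp add: R_def alphabet_def)
  have "inj_on F ?B"
  proof (rule inj_onI)
    fix T T' assume T: "T \<in> ?B" "T' \<in> ?B" and F: "F T = F T'"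
    have entry: "T k a j = T' k a j" if "k < c" "a \<in> alphabet b" "j < d" for k a j
    proof (cases "j < 2 * D")
      case True
      then have "j div 2 < D" by linarith
      then have "table_pair b c T (j div 2) (j mod 2, k, a) = table_pair b c T' (j div 2) (j mod 2, k, a)"
        using fun_cong[OF arg_cong[OF F, of fst], of "j div 2"] by (simp add: F_def)
      then show ?thesis using that by (simp add: table_pair_def entries_def)
    next
      case False
      then have "(k, a, j) \<in> R" using that by (simp add: R_def)
      moreover have "(\<lambda>(k, a, j)\<in>R. T k a j) (k, a, j) = (\<lambda>(k, a, j)\<in>R. T' k a j) (k, a, j)"
        using fun_cong[OF arg_cong[OF F, of snd], of "(k, a, j)"] by (simp add: F_def)
      ultimately show ?thesis by simp
    qed
    show "T = T'"
    proof (rule PiE_ext)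
      show "T \<in> {..<c} \<rightarrow>\<^sub>E (alphabet b \<rightarrow>\<^sub>E vectors b d)" "T' \<in> {..<c} \<rightarrow>\<^sub>E (alphabet b \<rightarrow>\<^sub>E vectors b d)"
        using T unfolding tables_def by blast+
      fix k assume k: "k \<in> {..<c}"
      then have Tk: "T k \<in> alphabet b \<rightarrow>\<^sub>E vectors b d" "T' k \<in> alphabet b \<rightarrow>\<^sub>E vectors b d"
        using T unfolding tables_def by blast+
      show "T k = T' k"
      proof (rule PiE_ext[OF Tk])
        fix a assume a: "a \<in> alphabet b"
        then have "T k a \<in> vectors b d" "T' k a \<in> vectors b d" using Tk by blast+
        then show "T k a = T' k a"
          unfolding vectors_def
        proof (rule PiE_ext)
          show "T k a j = T' k a j" if "j \<in> {..<d}" for j using entry[of k a j] k a that by simp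
        qed
      qed
    qed
  qed
  moreover have "F ` ?B \<subseteq> ({..<D} \<rightarrow>\<^sub>E A) \<times> (R \<rightarrow>\<^sub>E alphabet b)"
  proof (rule image_subsetI)
    fix T assume T: "T \<in> ?B"
    have "T k a j \<in> alphabet b" if "(k, a, j) \<in> R" for k a j
    proof -
      have "k \<in> {..<c}" "a \<in> alphabet b" "j \<in> {..<d}" using that by (simp_all add: R_def)
      then show ?thesis using T unfolding tables_def vectors_def by blast
    qed
    then have "(\<lambda>(k, a, j)\<in>R. T k a j) \<in> R \<rightarrow>\<^sub>E alphabet b" by auto
    moreover have "(\<lambda>p\<in>{..<D}. table_pair b c T p) \<in> {..<D} \<rightarrow>\<^sub>E A" using T by simp
    ultimately show "F T \<in> ({..<D} \<rightarrow>\<^sub>E A) \<times> (R \<rightarrow>\<^sub>E alphabet b)" unfolding F_def by (rule SigmaI[rotated])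
  qed
  ultimately have "card ?B \<le> card (({..<D} \<rightarrow>\<^sub>E A) \<times> (R \<rightarrow>\<^sub>E alphabet b))"
    using finA finR by (intro card_inj_on_le[of F] finite_cartesian_product finite_PiE) (simp_all add: alphabet_def)
  also have "\<dots> = card A ^ D * (2 ^ b) ^ card R"
    using finR by (simp add: card_cartesian_product card_PiE alphabet_def)
  finally have "card ?B \<le> card A ^ D * (2 ^ b) ^ card R" .
  then have "card ?B * card (entries b c \<rightarrow>\<^sub>E alphabet b) ^ D
      \<le> card A ^ D * ((2 ^ b) ^ card R * card (entries b c \<rightarrow>\<^sub>E alphabet b) ^ D)"
    unfolding mult.assoc[symmetric] by (rule mult_right_mono) simp
  also have "(2 ^ b) ^ card R * card (entries b c \<rightarrow>\<^sub>E alphabet b) ^ D = card (tables b c d)"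
  proof -
    have entries: "card (entries b c \<rightarrow>\<^sub>E alphabet b) = (2 ^ b) ^ (2 * c * 2 ^ b)"
    proof -
      have "card (entries b c) = 2 * c * 2 ^ b"
        by (simp add: entries_def alphabet_def card_cartesian_product)
      then show ?thesis using card_PiE[OF finite_entries, of b c "\<lambda>_. alphabet b"] by (simp add: alphabet_def)
    qed
    have "card R + 2 * c * 2 ^ b * D = (d - 2 * D + 2 * D) * (c * 2 ^ b)"
    proof -
      have "card R = c * (2 ^ b * (d - 2 * D))" by (simp add: R_def card_cartesian_product alphabet_def)
      moreover have "c * (m * u) + 2 * c * m * D = (u + 2 * D) * (c * m)" for m u :: nat
        by (simp add: algebra_simps)
      ultimately show ?thesis by (simp only:)
    qed
    also have "\<dots> = d * 2 ^ b * c" unfolding le_add_diff_inverse2[OF assms(2)] by (simp only: mult_ac)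
    finally have "(2 ^ b) ^ (card R + 2 * c * 2 ^ b * D) = card (tables b c d)"
      by (simp only: card_tables)
    then show ?thesis unfolding entries power_add power_mult[of "2 ^ b" "2 * c * 2 ^ b" D] .
  qed
  finally show ?thesis .
qed

text \<open>Let \<open>x\<close> be a light key of the current \<open>X\<close>. A subset violating
  peelability either contains \<open>x\<close>, which puts \<open>x\<close> into the core of all
  \<open>d div 2\<close> independent pair graphs, or lies in \<open>X - {x}\<close>, where the
  induction hypothesis applies. Which key is light depends on the current set.\<close>

lemma card_not_peelable_le:
  fixes r :: real
  assumes "finite X" "X \<subseteq> vectors b c" "card X \<le> r * 2 ^ b" "0 \<le> r" "r < 1"
  shows "real (card {T \<in> tables b c d. \<not> fully_peelable d (simple_tabulation c d T) X})
    \<le> card X * (core_const c r / 2 ^ b) ^ (d div 2) * card (tables b c d)"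
  using assms(1-3)
proof (induction X rule: finite_psubset_induct)
  case (psubset X)
  define D where "D = d div 2"
  define \<Omega> where "\<Omega> = entries b c \<rightarrow>\<^sub>E alphabet b"
  define N where "N X = {T \<in> tables b c d. \<not> fully_peelable d (simple_tabulation c d T) X}" for X
  define \<beta> where "\<beta> = core_const c r / 2 ^ b"
  show ?case
  proof (cases "X = {}")
    case True
    then show ?thesis by (simp add: fully_peelable_def)
  next
    case False
    obtain x where x: "x \<in> X" "real (card {T \<in> \<Omega>. edge_core c X T x}) \<le> \<beta> * card \<Omega>"
      using exists_light_key[OF psubset.hyps False psubset.prems assms(4,5)]
      unfolding \<Omega>_def \<beta>_def by blast
    define A where "A = {T \<in> \<Omega>. edge_core c X T x}"
    define B where "B = {T \<in> tables b c d. \<forall>p<D. table_pair b c T p \<in> A}"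
    have "N X \<subseteq> B \<union> N (X - {x})"
    proof
      fix T assume T: "T \<in> N X"
      then obtain Y where Y: "Y \<subseteq> X" "Y \<noteq> {}"
          "\<And>y. y \<in> Y \<Longrightarrow> \<not> has_unique_output_char d (simple_tabulation c d T) Y y"
        unfolding N_def fully_peelable_def by blast
      show "T \<in> B \<union> N (X - {x})"
      proof (cases "x \<in> Y")
        case True
        have "table_pair b c T p \<in> A" if "p < D" for p
        proof -
          have p: "2 * p + 1 < d" using that by (simp add: D_def)
          have "table_pair b c T p \<in> \<Omega>"
          proof -
            have "T k a (2 * p + e) \<in> alphabet b" if "e < 2" "k < c" "a \<in> alphabet b" for e k a
            proof -
              have "T k a \<in> vectors b d" using T that unfolding N_def tables_def by auto
              moreover have "2 * p + e < d" using p that by linarith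
              ultimately show ?thesis by (auto simp: vectors_def)
            qed
            then show ?thesis by (auto simp: \<Omega>_def table_pair_def entries_def)
          qed
          then show ?thesis
            using edge_core_if_not_peelable[OF psubset.prems(1) Y(1) True p Y(3)] by (simp add: A_def)
        qed
        then show ?thesis using T by (simp add: B_def N_def)
      next
        case False
        then have "Y \<subseteq> X - {x}" using Y(1) by blast
        then have "\<not> fully_peelable d (simple_tabulation c d T) (X - {x})"
          using Y(2,3) unfolding fully_peelable_def by blast
        then show ?thesis using T by (simp add: N_def)
      qed
    qed
    then have "card (N X) \<le> card (B \<union> N (X - {x}))"
      by (intro card_mono) (simp_all add: B_def N_def finite_table_set)
    also have "\<dots> \<le> card B + card (N (X - {x}))" by (rule card_Un_le)
    finally have NX: "real (card (N X)) \<le> card B + card (N (X - {x}))" by linarith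
    have pos: "0 < card \<Omega>"
      by (simp add: \<Omega>_def card_PiE finite_entries alphabet_def)
    have "card B * card \<Omega> ^ D \<le> card A ^ D * card (tables b c d)"
      unfolding B_def \<Omega>_def by (rule card_table_pairs_le) (auto simp: A_def \<Omega>_def D_def)
    then have "real (card B) * real (card \<Omega>) ^ D \<le> real (card A) ^ D * card (tables b c d)"
      unfolding of_nat_power[symmetric] of_nat_mult[symmetric] of_nat_le_iff .
    also have "\<dots> \<le> (\<beta> * card \<Omega>) ^ D * card (tables b c d)"
      using x(2) by (intro mult_right_mono power_mono) (simp_all add: A_def)
    also have "\<dots> = \<beta> ^ D * card (tables b c d) * real (card \<Omega>) ^ D"
      by (simp only: power_mult_distrib ac_simps)
    finally have B: "real (card B) \<le> \<beta> ^ D * card (tables b c d)"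
      using pos by simp
    have cardX: "real (card X) = real (card (X - {x})) + 1"
      using card_Suc_Diff1[OF psubset.hyps x(1)] by linarith
    have "X - {x} \<subset> X" using x(1) by blast
    moreover have "real (card (X - {x})) \<le> r * 2 ^ b" using cardX psubset.prems(2) by linarith
    ultimately have "real (card (N (X - {x}))) \<le> card (X - {x}) * \<beta> ^ D * card (tables b c d)"
      using psubset.IH[of "X - {x}"] psubset.prems(1) unfolding N_def \<beta>_def D_def by auto
    then have "real (card (N X)) \<le> (card (X - {x}) + 1) * \<beta> ^ D * card (tables b c d)"
      using NX B by (simp add: algebra_simps)
    then show ?thesis unfolding N_def \<beta>_def D_def cardX by (simp add: add.commute)
  qed
qed

theorem theorem8:
  fixes c d :: nat and \<epsilon> :: real
  assumes "c \<ge> 1" and "\<epsilon> > 0"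
  shows "\<exists>C::real. \<forall>(b::nat) X.
           X \<subseteq> vectors b c \<and> real (card X) \<le> real (card (alphabet b)) / (1 + \<epsilon>) \<longrightarrow>
           measure_pmf.prob (random_tables b c d)
             {T. fully_peelable d (simple_tabulation c d T) X}
             \<ge> 1 - C * real (card (alphabet b)) powi (1 - int (d div 2))"
proof (intro exI allI impI, elim conjE)
  fix b X
  define r where "r = 1 / (1 + \<epsilon>)"
  define D where "D = d div 2"
  define m :: real where "m = 2 ^ b"
  let ?N = "{T. \<not> fully_peelable d (simple_tabulation c d T) X}"
  assume X: "X \<subseteq> vectors b c" "real (card X) \<le> real (card (alphabet b)) / (1 + \<epsilon>)"
  have r: "0 \<le> r" "r < 1" using assms(2) by (simp_all add: r_def)
  have m: "0 < m" "real (card (alphabet b)) = m" by (simp_all add: m_def alphabet_def)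
  have cardX: "real (card X) \<le> r * 2 ^ b" using X(2) by (simp add: r_def alphabet_def)
  have finX: "finite X" using X(1) finite_vectors finite_subset by blast
  have pos: "0 < card (tables b c d)" by (simp add: card_tables)
  then have ne: "tables b c d \<noteq> {}" by auto
  have const: "0 \<le> core_const c r"
    unfolding core_const_def by (intro suminf_nonneg summable_walk_bound r) (simp add: r)
  have "measure_pmf.prob (random_tables b c d) ?N = card (tables b c d \<inter> ?N) / card (tables b c d)"
    unfolding random_tables_eq by (rule measure_pmf_of_set[OF ne finite_table_set])
  also have "tables b c d \<inter> ?N = {T \<in> tables b c d. \<not> fully_peelable d (simple_tabulation c d T) X}"
    by blast
  also have "card \<dots> / card (tables b c d) \<le> card X * (core_const c r / m) ^ D"
    using card_not_peelable_le[OF finX X(1) cardX r, of d] pos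
    unfolding D_def m_def by (simp add: divide_le_eq)
  \<comment> \<open>The union over at most \<open>m\<close> removals accounts for the 1 in the
    exponent \<open>1 - int D\<close>.\<close>
  also have "\<dots> \<le> m * (core_const c r / m) ^ D"
  proof (rule mult_right_mono)
    have "r * m \<le> 1 * m" using r m by (intro mult_right_mono) auto
    then show "real (card X) \<le> m" using cardX unfolding m_def by linarith
  qed (use const m in simp)
  also have "\<dots> = core_const c r ^ D * m powi (1 - int D)"
    using m(1) by (simp add: power_int_diff power_divide)
  finally have "measure_pmf.prob (random_tables b c d) ?N \<le> core_const c r ^ D * m powi (1 - int D)" .
  moreover have "measure_pmf.prob (random_tables b c d) {T. fully_peelable d (simple_tabulation c d T) X} =
      1 - measure_pmf.prob (random_tables b c d) ?N"
    by (subst measure_pmf.prob_compl[symmetric]) (auto intro: arg_cong[where f = "measure_pmf.prob _"])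
  \<comment> \<open>This fixes the existential constant; it depends only on \<open>c\<close>,
    \<open>d\<close> and \<epsilon>.\<close>
  ultimately show "1 - core_const c (1 / (1 + \<epsilon>)) ^ (d div 2) * real (card (alphabet b)) powi (1 - int (d div 2))
      \<le> measure_pmf.prob (random_tables b c d) {T. fully_peelable d (simple_tabulation c d T) X}"
    unfolding m(2) D_def r_def by simp
qed

end
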